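(* For all $n \geq 4$, $\mathrm{Alt}(\{0,1\}^n) = \langle e^{57}_n, \sigma_n \rangle = \langle e^{99}_n, \sigma_n \rangle$.
   Context: Let $n \geq 4$. Words $w \in \{0,1\}^n$ are indexed by $0, \dots, n-1$, with indices read modulo $n$. $\mathrm{Alt}(\{0,1\}^n)$ is the alternating group on the set of $2^n$ binary words of length $n$, and $\langle \cdots \rangle$ denotes the generated group of permutations of $\{0,1\}^n$. The map $\sigma_n : \{0,1\}^n \to \{0,1\}^n$ is the cyclic shift $\sigma_n(aw) = wa$ for $a \in \{0,1\}$, $w \in \{0,1\}^{n-1}$. The maps $e^{57}_n$ and $e^{99}_n$ are the asynchronous applications at cell $0$ of the elementary cellular automata with Wolfram numbers $57$ and $99$ on a cycle of $n$ cells. Explicitly: $e^{57}_n(w)_i = w_i$ for $i \neq 0$, and $e^{57}_n(w)_0 = 1 - w_0$ unless $w_{n-1} = 0$ and $w_1 = 1$, in which case $e^{57}_n(w)_0 = w_0$. The map $e^{99}_n$ is its mirror image: $e^{99}_n(w)_i = w_i$ for $i \neq 0$, and $e^{99}_n(w)_0 = 1 - w_0$ unless $w_{n-1} = 1$ and $w_1 = 0$, in which case $e^{99}_n(w)_0 = w_0$. (The superscripts are indices, not powers.) *)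

theory Defs
  imports "HOL-Algebra.Sym_Groups"
begin

text \<open>Binary words are Boolean lists, with \<open>False\<close> for 0 and \<open>True\<close> for 1; the letter
  with index \<open>i\<close> is \<open>w ! i\<close>.\<close>

definition words :: "nat \<Rightarrow> bool list set"
  where "words n = {w. length w = n}"

text \<open>The symmetric and alternating groups on a set \<open>S\<close>, generalizing \<^const>\<open>sym_group\<close> and
  \<^const>\<open>alt_group\<close>, which are the case \<open>S = {1..n}\<close>. As there, a permutation of \<open>S\<close> is
  a function on the whole type that is the identity outside \<open>S\<close>; therefore the maps below
  are extended by the identity to lists of length other than \<open>n\<close>.\<close>

definition sym_group_on :: "'a set \<Rightarrow> ('a \<Rightarrow> 'a) monoid"
  where "sym_group_on S = \<lparr> carrier = {p. p permutes S}, mult = (\<circ>), one = id \<rparr>"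

definition alt_group_on :: "'a set \<Rightarrow> ('a \<Rightarrow> 'a) monoid"
  where "alt_group_on S = (sym_group_on S) \<lparr> carrier := {p. p permutes S \<and> evenperm p} \<rparr>"

definition shift :: "nat \<Rightarrow> bool list \<Rightarrow> bool list"
  where "shift n w = (if w \<in> words n then rotate1 w else w)"

text \<open>Here \<open>n - 1\<close> is the left neighbour of cell 0 on the cycle.\<close>

definition e57 :: "nat \<Rightarrow> bool list \<Rightarrow> bool list"
  where "e57 n w =
    (if w \<in> words n \<and> \<not> (w ! (n - 1) = False \<and> w ! 1 = True) then w[0 := \<not> w ! 0] else w)"

definition e99 :: "nat \<Rightarrow> bool list \<Rightarrow> bool list"
  where "e99 n w =
    (if w \<in> words n \<and> \<not> (w ! (n - 1) = True \<and> w ! 1 = False) then w[0 := \<not> w ! 0] else w)"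

text \<open>The following facts ensure that inverses in \<open>generate (sym_group_on (words n))\<close> are the
  inverse permutations.\<close>

lemma group_sym_group_on: "group (sym_group_on S)"
proof (rule groupI)
  fix p assume "p \<in> carrier (sym_group_on S)"
  then have p: "p permutes S"
    by (simp add: sym_group_on_def)
  show "\<exists>q \<in> carrier (sym_group_on S). q \<otimes>\<^bsub>sym_group_on S\<^esub> p = \<one>\<^bsub>sym_group_on S\<^esub>"
    using permutes_inv[OF p] permutes_inv_o(2)[OF p] by (auto simp: sym_group_on_def)
qed (auto simp: sym_group_on_def permutes_compose permutes_id comp_assoc)

lemma shift_permutes: "shift n permutes words n"
proof (rule bij_imp_permutes)
  have rot: "rotate (n - 1) (rotate1 w) = w \<and> rotate1 (rotate (n - 1) w) = w"
    if "length w = n" for w :: "bool list"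
  proof (cases n)
    case (Suc m)
    have "rotate (Suc m) w = w"
      using that Suc by (simp add: rotate_id del: rotate_Suc)
    then show ?thesis
      using Suc by (simp add: rotate1_rotate_swap)
  qed (use that in simp)
  show "bij_betw (shift n) (words n) (words n)"
    by (rule bij_betw_byWitness[where f' = "rotate (n - 1)"])
      (auto simp: shift_def words_def rot simp del: One_nat_def)
qed (simp add: shift_def)

lemma e57_permutes: "n \<ge> 2 \<Longrightarrow> e57 n permutes words n"
  by (rule bij_imp_permutes, rule bij_betw_byWitness[where f' = "e57 n"])
    (auto simp: e57_def words_def)

lemma e99_permutes: "n \<ge> 2 \<Longrightarrow> e99 n permutes words n"
  by (rule bij_imp_permutes, rule bij_betw_byWitness[where f' = "e99 n"])
    (auto simp: e99_def words_def)

end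

theory Submission
  imports Defs
begin

text \<open>Conjugating \<open>e57\<close> by the shift gives the gates \<open>F\<^sub>i\<close> that flip cell \<open>i\<close> unless its
  left and right neighbours are 0 and 1. On four consecutive cells, \<open>F\<^sub>1 F\<^sub>2\<close> has order 3 if the
  boundary cells are 0 and 1 and order 2 or 4 otherwise, so its fourth power is a 3-cycle of
  words of length 4, applied in every context. Two permutations with a single common
  moved point have a 3-cycle as commutator; applied to 3-cycles on two rows of \<open>k\<close> cells that
  are offset by one cell, this produces 3-cycles on rows of \<open>k + 1\<close> cells, and by induction all
  3-cycles of words of length \<open>n\<close> that begin with 0 and end with 1. Invariance under the
  group then yields all 3-cycles, hence all even permutations. The generators are even:
  \<open>e57\<close>, and each transposition of adjacent cells that the shift is composed of, acts
  independently of some cell. Finally, complementing all letters exchanges \<open>e57\<close> and \<open>e99\<close>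
  and commutes with the shift.\<close>

subsection \<open>Permutation groups containing 3-cycles\<close>

definition cyc3 :: "'a \<Rightarrow> 'a \<Rightarrow> 'a \<Rightarrow> 'a \<Rightarrow> 'a"
  where "cyc3 a b c x = (if x = a then b else if x = b then c else if x = c then a else x)"

lemma inv_cyc3: "distinct [a, b, c] \<Longrightarrow> inv' (cyc3 a b c) = cyc3 c b a"
  by (rule inv_unique_comp) (auto simp: cyc3_def fun_eq_iff)

lemma cyc3_rotate: "distinct [a, b, c] \<Longrightarrow> cyc3 b c a = cyc3 a b c"
  by (auto simp: cyc3_def fun_eq_iff)

lemma cyc3_conj:
  assumes "bij q"
  shows "q \<circ> cyc3 a b c \<circ> inv' q = cyc3 (q a) (q b) (q c)"
proof
  fix x
  obtain y where "x = q y"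
    using assms by (metis bij_pointE)
  then show "(q \<circ> cyc3 a b c \<circ> inv' q) x = cyc3 (q a) (q b) (q c) x"
    using assms by (auto simp: cyc3_def bij_is_inj inj_eq inv_f_f)
qed

lemma cyc3_moves_iff: "distinct [a, b, c] \<Longrightarrow> cyc3 a b c x \<noteq> x \<longleftrightarrow> x \<in> {a, b, c}"
  by (auto simp: cyc3_def)

lemma transpose_transpose_eq_cyc3:
  "a \<noteq> b \<Longrightarrow> c \<noteq> a \<Longrightarrow> c \<noteq> b \<Longrightarrow> transpose a b \<circ> transpose b c = cyc3 a b c"
  by (auto simp: cyc3_def transpose_def fun_eq_iff)

text \<open>\<open>p\<close> and \<open>q\<close> map points other than \<open>z\<close> that they
  move in such a way that \<open>q\<close> fixes \<open>p z\<close> and \<open>p\<close> fixes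
  \<open>q z\<close>. Hence \<open>p \<circ> q\<close> and \<open>q \<circ> p\<close> differ only
  through the three points \<open>z\<close>, \<open>p z\<close>, \<open>q z\<close>; the cases
  record which of the two maps moves \<open>y\<close>.\<close>

lemma commutator_eq_cyc3:
  assumes "bij p" "bij q" and z: "\<And>x. p x \<noteq> x \<and> q x \<noteq> x \<longleftrightarrow> x = z"
  shows "p \<circ> q \<circ> inv' p \<circ> inv' q = cyc3 z (p z) (q z)"
    and "distinct [z, p z, q z]"
proof -
  have inj: "p x = p y \<longleftrightarrow> x = y" "q x = q y \<longleftrightarrow> x = y" for x y
    using assms by (auto simp: bij_is_inj inj_eq)
  show dist: "distinct [z, p z, q z]"
    using z[of z] inj z[of "p z"] by auto
  have z': "p x = x \<or> q x = x" if "x \<noteq> z" for x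
    using z that by blast
  have "p (q y) = cyc3 z (p z) (q z) (q (p y))" for y
  proof -
    consider "y = z" | "y \<noteq> z" "p y \<noteq> y" "q y = y" | "y \<noteq> z" "q y \<noteq> y" "p y = y"
      | "y \<noteq> z" "p y = y" "q y = y"
      using z' by blast
    then show ?thesis
    proof cases
      case 1
      then show ?thesis using dist z'[of "q z"] z'[of "p z"] inj by (auto simp: cyc3_def)
    next
      case 2
      then show ?thesis using dist z'[of "q z"] z'[of "p y"] inj by (auto simp: cyc3_def)
    next
      case 3
      then show ?thesis using dist z'[of "p z"] z'[of "q y"] inj by (auto simp: cyc3_def)
    next
      case 4
      then show ?thesis using dist z'[of "p z"] z'[of "q z"] inj by (auto simp: cyc3_def)
    qed
  qed
  then have "p \<circ> q = cyc3 z (p z) (q z) \<circ> (q \<circ> p)"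
    by (auto simp: fun_eq_iff)
  then have "p \<circ> q \<circ> inv' p \<circ> inv' q = cyc3 z (p z) (q z) \<circ> ((q \<circ> (p \<circ> inv' p)) \<circ> inv' q)"
    by (simp add: comp_assoc)
  then show "p \<circ> q \<circ> inv' p \<circ> inv' q = cyc3 z (p z) (q z)"
    using assms by (simp add: bij_is_surj surj_iff[THEN iffD1])
qed

definition linked :: "('a \<Rightarrow> 'a) set \<Rightarrow> 'a \<Rightarrow> 'a \<Rightarrow> bool"
  where "linked H a b \<longleftrightarrow> a = b \<or> (\<exists>c. distinct [a, b, c] \<and> cyc3 a b c \<in> H)"

section \<open>Permutation groups and their linked points\<close>

locale perm_group =
  fixes S :: "'a set" and H :: "('a \<Rightarrow> 'a) set"
  assumes permutes: "p \<in> H \<Longrightarrow> p permutes S"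
    and id_mem: "id \<in> H"
    and comp_mem: "p \<in> H \<Longrightarrow> q \<in> H \<Longrightarrow> p \<circ> q \<in> H"
    and inv_mem: "p \<in> H \<Longrightarrow> inv' p \<in> H"
begin

lemma bij: "p \<in> H \<Longrightarrow> bij p"
  using permutes permutes_bij by blast

lemma conj_cyc3_mem: "q \<in> H \<Longrightarrow> cyc3 a b c \<in> H \<Longrightarrow> cyc3 (q a) (q b) (q c) \<in> H"
  using comp_mem[OF comp_mem inv_mem, of q "cyc3 a b c" q] by (simp add: cyc3_conj bij)

lemma rev_cyc3_mem: "distinct [a, b, c] \<Longrightarrow> cyc3 a b c \<in> H \<Longrightarrow> cyc3 c b a \<in> H"
  using inv_mem[of "cyc3 a b c"] by (simp add: inv_cyc3)

text \<open>Conjugating the cycle \<open>a b x\<close> by the cycle \<open>b c y\<close> replaces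
  \<open>b\<close> by \<open>c\<close>. The cases are the possible coincidences of the auxiliary
  points \<open>x\<close> and \<open>y\<close> with \<open>c\<close>, with \<open>a\<close> and with
  each other.\<close>

lemma cyc3_mem_if_linked:
  assumes "linked H a b" "linked H b c" and dist: "distinct [a, b, c]"
  shows "cyc3 a b c \<in> H"
proof -
  obtain x y where x: "distinct [a, b, x]" "cyc3 a b x \<in> H" and y: "distinct [b, c, y]" "cyc3 b c y \<in> H"
    using assms by (auto simp: linked_def)
  have conj: "cyc3 (cyc3 b c y a) (cyc3 b c y b) (cyc3 b c y x) \<in> H"
    by (rule conj_cyc3_mem[OF y(2) x(2)])
  consider "x = c" | "y = a" | "x = y" "x \<noteq> c" "y \<noteq> a" | "x \<noteq> y" "x \<noteq> c" "y \<noteq> a" by blast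
  then show ?thesis
  proof cases
    case 1
    then show ?thesis using x by simp
  next
    case 2
    then show ?thesis using y dist cyc3_rotate[of a b c] by simp
  next
    case 3
    then have "cyc3 a c b \<in> H"
      using conj x y dist by (auto simp: cyc3_def[of b])
    then have "cyc3 b c a \<in> H"
      using dist rev_cyc3_mem[of a c b] by auto
    then show ?thesis using dist cyc3_rotate[of a b c] by simp
  next
    case 4
    then have "cyc3 a c x \<in> H"
      using conj x y dist by (auto simp: cyc3_def[of b])
    \<comment> \<open>Conjugation by \<open>cyc3 a c x\<close> sends \<open>a\<close>,
      \<open>b\<close>, \<open>x\<close> to \<open>c\<close>, \<open>b\<close>, \<open>a\<close>,
      which eliminates \<open>x\<close>.\<close>
    from conj_cyc3_mem[OF this x(2)] have "cyc3 c b a \<in> H"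
      using 4 x y dist by (auto simp: cyc3_def[of a c])
    then show ?thesis
      using rev_cyc3_mem[of c b a] dist by auto
  qed
qed

lemma linked_refl [simp]: "linked H a a"
  by (simp add: linked_def)

lemma linked_cyc3: "distinct [a, b, c] \<Longrightarrow> cyc3 a b c \<in> H \<Longrightarrow> linked H a b"
  by (auto simp: linked_def)

lemma linked_sym: "linked H a b \<Longrightarrow> linked H b a"
proof (cases "a = b")
  case False
  assume "linked H a b"
  then obtain c where "distinct [a, b, c]" "cyc3 a b c \<in> H"
    using False by (auto simp: linked_def)
  then have "cyc3 b a c \<in> H" "distinct [b, a, c]"
    using rev_cyc3_mem[of a b c] cyc3_rotate[of c b a] by auto
  then show ?thesis by (rule linked_cyc3[rotated])
qed simp

lemma linked_trans: "linked H a b \<Longrightarrow> linked H b c \<Longrightarrow> linked H a c"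
proof (cases "distinct [a, b, c]")
  case True
  assume "linked H a b" "linked H b c"
  then have "cyc3 c b a \<in> H"
    using cyc3_mem_if_linked[OF _ _ True] rev_cyc3_mem[OF True] by simp
  then have "cyc3 a c b \<in> H" 
    using True cyc3_rotate[of a c b] cyc3_rotate[of b a c] by auto
  then show ?thesis using True linked_cyc3[of a c b] by auto
qed auto

lemma linked_image:
  assumes "q \<in> H" "linked H a b"
  shows "linked H (q a) (q b)"
proof (cases "a = b")
  case False
  then obtain c where "distinct [a, b, c]" "cyc3 a b c \<in> H"
    using assms by (auto simp: linked_def)
  then show ?thesis
    using conj_cyc3_mem[OF assms(1)] bij[OF assms(1)]
    by (intro linked_cyc3[of _ _ "q c"]) (auto simp: bij_is_inj inj_eq)
qed simp

lemma linked_commutator: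
  assumes "p \<in> H" "q \<in> H" and z: "\<And>x. p x \<noteq> x \<and> q x \<noteq> x \<longleftrightarrow> x = z"
  shows "linked H z (p z)" and "linked H z (q z)"
proof -
  have d: "distinct [z, p z, q z]" and c: "cyc3 z (p z) (q z) \<in> H"
    using commutator_eq_cyc3[OF bij[OF assms(1)] bij[OF assms(2)] z]
      comp_mem[OF comp_mem[OF comp_mem[OF assms(1,2)] inv_mem[OF assms(1)]] inv_mem[OF assms(2)]]
    by simp_all
  show "linked H z (p z)"
    using linked_cyc3[OF d c] .
  have "cyc3 (q z) (p z) z \<in> H"
    using rev_cyc3_mem[OF d c] .
  then have "cyc3 z (q z) (p z) \<in> H"
    using cyc3_rotate[of z "q z" "p z"] cyc3_rotate[of "p z" z "q z"] d by auto
  then show "linked H z (q z)"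
    using d linked_cyc3[of z "q z" "p z"] by auto
qed

text \<open>Linkedness puts every product of two transpositions with a common point into
  \<open>H\<close>. Therefore \<open>H\<close> has index at most 2 in the symmetric group, a fixed
  transposition of \<open>s\<close> and \<open>t\<close> representing the other coset, and parity
  decides the coset.\<close>

lemma even_mem:
  assumes "finite S" and linked: "\<And>a b. a \<in> S \<Longrightarrow> b \<in> S \<Longrightarrow> linked H a b"
    and even: "\<And>p. p \<in> H \<Longrightarrow> evenperm p"
    and p: "p permutes S" "evenperm p"
  shows "p \<in> H"
proof (cases "\<exists>s \<in> S. \<exists>t \<in> S. s \<noteq> t")
  case False
  then have "p = id"
    using p permutes_in_image[OF p(1)] permutes_not_in[OF p(1)] by (fastforce simp: fun_eq_iff)
  then show ?thesis by (simp add: id_mem)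
next
  case True
  then obtain s t where st: "s \<in> S" "t \<in> S" "s \<noteq> t" by blast
  have cyc: "transpose a b \<circ> transpose b c \<in> H" if "a \<in> S" "b \<in> S" "c \<in> S" "a \<noteq> b" "b \<noteq> c" for a b c
  proof (cases "a = c")
    case True
    then show ?thesis by (simp add: id_mem transpose_commute[of b c])
  next
    case False
    then show ?thesis
      using cyc3_mem_if_linked[of a b c] that linked transpose_transpose_eq_cyc3[of a b c] by auto
  qed
  have two: "transpose a b \<circ> transpose s t \<in> H" if "a \<in> S" "b \<in> S" "a \<noteq> b" for a b
  proof (cases "b = s")
    case True
    then show ?thesis using cyc that st by simp
  next
    case False
    \<comment> \<open>Inserting \<open>transpose b s\<close> twice splits the product into two
      products of transpositions that share a point.\<close>
    then have "(transpose a b \<circ> transpose b s) \<circ> (transpose b s \<circ> transpose s t) \<in> H"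
      using comp_mem[OF cyc cyc] that st by simp
    moreover have "(transpose a b \<circ> transpose b s) \<circ> (transpose b s \<circ> transpose s t) = transpose a b \<circ> transpose s t"
      by (simp add: fun_eq_iff)
    ultimately show ?thesis by simp
  qed
  have two': "transpose s t \<circ> transpose a b \<in> H" if "a \<in> S" "b \<in> S" "a \<noteq> b" for a b
    using inv_mem[OF two[OF that]] by (simp add: o_inv_distrib)
  have "p \<in> H \<or> transpose s t \<circ> p \<in> H"
    using p(1) \<open>finite S\<close>
  proof (induction rule: permutes_induct)
    case id
    show ?case using id_mem by (rule disjI1)
  next
    case (swap a b p)
    from swap.IH show ?case
    proof
      assume "p \<in> H"
      from comp_mem[OF two'[OF swap.hyps(1-3)] this] show ?thesis
        unfolding comp_assoc by (rule disjI2)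
    next
      assume "transpose s t \<circ> p \<in> H"
      from comp_mem[OF two[OF swap.hyps(1-3)] this]
      moreover have "(transpose a b \<circ> transpose s t) \<circ> (transpose s t \<circ> p) = transpose a b \<circ> p"
        by (simp add: fun_eq_iff)
      ultimately have "transpose a b \<circ> p \<in> H" by argo
      then show ?thesis ..
    qed
  qed
  moreover have "transpose s t \<circ> p \<notin> H"
  proof
    assume "transpose s t \<circ> p \<in> H"
    then have "evenperm (transpose s t \<circ> p)" by (rule even)
    moreover have "permutation p"
      using p(1) \<open>finite S\<close> by (auto simp: permutation_permutes)
    ultimately show False
      using p(2) st by (simp add: evenperm_comp permutation_swap_id evenperm_swap)
  qed
  ultimately show ?thesis by simp
qed

end

subsection \<open>Parity of the generators\<close>

definition flip :: "nat \<Rightarrow> bool list \<Rightarrow> bool list"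
  where "flip i w = w[i := \<not> w ! i]"

lemma length_flip [simp]: "length (flip i w) = length w"
  by (simp add: flip_def)

lemma flip_flip [simp]: "flip i (flip i w) = w"
  by (cases "i < length w") (auto simp: flip_def list_update_beyond)

lemma nth_flip: "i < length w \<Longrightarrow> flip i w ! j = (if i = j then \<not> w ! j else w ! j)"
  by (simp add: flip_def nth_list_update)

lemma flip_commute: "flip i (flip j w) = flip j (flip i w)"
  by (cases "i = j") (simp_all add: flip_def list_update_swap)

lemma finite_words: "finite (words n)"
  unfolding words_def using finite_lists_length_eq[of "UNIV :: bool set" n] by simp

lemma involution_permutes:
  assumes "\<And>x. x \<in> S \<Longrightarrow> f x \<in> S" "\<And>x. x \<in> S \<Longrightarrow> f (f x) = x" "\<And>x. x \<notin> S \<Longrightarrow> f x = x"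
  shows "f permutes S"
  by (rule bij_imp_permutes, rule bij_betw_byWitness[where f' = f]) (use assms in auto)

lemma evenperm_conj:
  assumes "finite S" "q permutes S" "p permutes S"
  shows "evenperm (q \<circ> p \<circ> inv' q) = evenperm p"
proof -
  have "permutation p" "permutation q" "permutation (inv' q)"
    using assms permutes_inv by (auto simp: permutation_permutes)
  then show ?thesis
    by (auto simp: evenperm_comp permutation_compose evenperm_inv)
qed

text \<open>The restrictions of \<open>f\<close> to the words with \<open>w ! i = False\<close> and \<open>w ! i = True\<close> are conjugate,
  hence have the same sign.\<close>

lemma evenperm_if_independent:
  assumes f: "f permutes words n" and i: "i < n"
    and nth: "\<And>w. length w = n \<Longrightarrow> f w ! i = w ! i"
    and commute: "\<And>w. length w = n \<Longrightarrow> f (flip i w) = flip i (f w)"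
  shows "evenperm f"
proof -
  define g where "g w = (if length w = n \<and> \<not> w ! i then f w else w)" for w
  define t where "t w = (if length w = n then flip i w else w)" for w
  have len: "length (f w) = n \<longleftrightarrow> length w = n" for w
    using permutes_in_image[OF f, of w] by (simp add: words_def)
  have len': "length (inv' f w) = n \<longleftrightarrow> length w = n" for w
    using permutes_in_image[OF permutes_inv[OF f], of w] by (simp add: words_def)
  have nth': "inv' f w ! i = w ! i" if "length w = n" for w
    using nth[of "inv' f w"] that len' permutes_inverses[OF f] by simp
  have t: "t permutes words n"
    by (rule involution_permutes) (auto simp: t_def words_def)
  have t_t: "t \<circ> t = id"
    by (auto simp: t_def fun_eq_iff)
  then have inv_t: "inv' t = t"
    by (rule inv_unique_comp[OF _ t_t])
  have g: "g permutes words n"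
  proof (rule bij_imp_permutes)
    show "bij_betw g (words n) (words n)"
      by (rule bij_betw_byWitness[where f' = "\<lambda>w. if length w = n \<and> \<not> w ! i then inv' f w else w"])
        (use len len' nth nth' in \<open>auto simp: g_def words_def permutes_inverses[OF f]\<close>)
  qed (simp add: g_def words_def)
  have "f = g \<circ> (t \<circ> g \<circ> inv' t)"
  proof
    fix w
    show "f w = (g \<circ> (t \<circ> g \<circ> inv' t)) w"
      using commute[of w] nth[of w] len[of w] nth_flip[of i w i] nth_flip[of i "f w" i] i
        permutes_not_in[OF f, of w]
      by (cases "length w = n") (auto simp: inv_t g_def t_def words_def)
  qed
  moreover have "evenperm (t \<circ> g \<circ> inv' t) = evenperm g"
    by (rule evenperm_conj[OF finite_words t g])
  moreover have "permutation g" "permutation (t \<circ> g \<circ> inv' t)"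
    using g permutes_compose[OF permutes_inv[OF t] permutes_compose[OF g t]] finite_words
    by (auto simp: permutation_permutes comp_assoc)
  ultimately show ?thesis
    by (simp add: evenperm_comp)
qed

lemma evenperm_e57:
  assumes "n \<ge> 4"
  shows "evenperm (e57 n)"
\<comment> \<open>\<open>e57\<close> reads only cells \<open>n - 1\<close>, 0 and 1, and
  \<open>n >= 4\<close> keeps cell 2 apart from these.\<close>
proof (rule evenperm_if_independent[where n = n and i = 2])
  show "e57 n permutes words n"
    using assms by (intro e57_permutes) simp
  show "e57 n (flip 2 w) = flip 2 (e57 n w)" if "length w = n" for w
    using assms that nth_flip[of 2 w 1] nth_flip[of 2 w "n - 1"] nth_flip[of 2 w 0]
      flip_commute[of 0 2 w]
    by (auto simp: e57_def words_def flip_def[of 0])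
qed (use assms in \<open>auto simp: e57_def words_def\<close>)

text \<open>Rotating only the first \<open>k\<close> cells interpolates between the identity at
  \<open>k = 1\<close> and the shift at \<open>k = n\<close>, so that parity can be followed by
  induction.\<close>

definition rot :: "nat \<Rightarrow> nat \<Rightarrow> bool list \<Rightarrow> bool list"
  where "rot n k w = (if length w = n then rotate1 (take k w) @ drop k w else w)"

definition swap_cells :: "nat \<Rightarrow> nat \<Rightarrow> bool list \<Rightarrow> bool list"
  where "swap_cells n k w = (if length w = n then w[k := w ! Suc k, Suc k := w ! k] else w)"

lemma evenperm_swap_cells:
  assumes "n \<ge> 3" "Suc k < n"
  shows "swap_cells n k permutes words n" "evenperm (swap_cells n k)"
proof -
  show perm: "swap_cells n k permutes words n"
    by (rule involution_permutes)
      (use assms in \<open>auto simp: swap_cells_def words_def list_eq_iff_nth_eq nth_list_update\<close>)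
  \<comment> \<open>A cell outside the swapped pair, on which the swap does not depend.\<close>
  define i where "i = (if k = 0 then 2 else 0 :: nat)"
  have i: "i < n" "i \<noteq> k" "i \<noteq> Suc k"
    using assms by (auto simp: i_def)
  show "evenperm (swap_cells n k)"
    by (rule evenperm_if_independent[OF perm i(1)])
      (use i assms in \<open>auto simp: swap_cells_def list_eq_iff_nth_eq nth_list_update nth_flip\<close>)
qed

text \<open>Rotating \<open>k\<close> cells brings the first letter to index \<open>k - 1\<close>;
  swapping it with its right neighbour carries it on to index \<open>k\<close>.\<close>

lemma rot_Suc:
  assumes "k > 0" "Suc k \<le> n"
  shows "rot n (Suc k) = swap_cells n (k - 1) \<circ> rot n k"
proof
  fix w :: "bool list"
  show "rot n (Suc k) w = (swap_cells n (k - 1) \<circ> rot n k) w"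
  proof (cases "length w = n")
    case True
    define u where "u = take k w"
    obtain b v where v: "drop k w = b # v"
      using assms True by (cases "drop k w") auto
    have "length u = k" using assms True by (simp add: u_def)
    with assms obtain a u' where u': "u = a # u'" by (cases u) auto
    have w: "w = u @ b # v"
      using v u_def append_take_drop_id[of k w] by simp
    have "take k w = u" "drop k w = b # v" "take (Suc k) w = u @ [b]" "drop (Suc k) w = v"
      using \<open>length u = k\<close> by (auto simp: w)
    moreover have "k = Suc (length u')"
      using \<open>length u = k\<close> u' by simp
    ultimately show ?thesis
      using True by (simp add: rot_def swap_cells_def w u' nth_append list_update_append)
  qed (simp add: rot_def swap_cells_def)
qed

lemma evenperm_rot:
  assumes "n \<ge> 3" "0 < k" "k \<le> n"
  shows "rot n k permutes words n \<and> evenperm (rot n k)"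
  using assms(2,3)
proof (induction k rule: nat_induct_non_zero)
  case 1
  have "rotate1 (take 1 w) @ drop 1 w = w" for w :: "bool list"
    by (cases w) auto
  then have "rot n 1 = id"
    unfolding rot_def by (simp only: if_cancel) (simp add: fun_eq_iff)
  then show ?case
    by (simp only: permutes_id evenperm_id)
next
  case (Suc k)
  have s: "swap_cells n (k - 1) permutes words n" "evenperm (swap_cells n (k - 1))"
    using evenperm_swap_cells[of n "k - 1"] assms Suc by auto
  have r: "rot n k permutes words n" "evenperm (rot n k)"
    using Suc by auto
  have "permutation (swap_cells n (k - 1))" "permutation (rot n k)"
    using s r finite_words by (auto simp: permutation_permutes)
  then show ?case
    using s r permutes_compose[OF r(1) s(1)] rot_Suc[OF Suc(1), of n] Suc
    by (simp only: evenperm_comp)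
qed

lemma evenperm_shift:
  assumes "n \<ge> 3"
  shows "evenperm (shift n)"
proof -
  have "shift n = rot n n"
    by (auto simp: shift_def rot_def words_def fun_eq_iff)
  then show ?thesis
    using evenperm_rot[of n n] assms by simp
qed

subsection \<open>Gates and rows\<close>

text \<open>\<open>lift n k p\<close> lets \<open>p\<close> act on cells \<open>0, ..., k - 1\<close> of words of length \<open>n\<close>, and
  \<open>lift_tl (Suc k) p\<close> lets it act on cells \<open>1, ..., k\<close> of words of length \<open>k + 1\<close>.\<close>

definition lift :: "nat \<Rightarrow> nat \<Rightarrow> (bool list \<Rightarrow> bool list) \<Rightarrow> bool list \<Rightarrow> bool list"
  where "lift n k p w = (if length w = n then p (take k w) @ drop k w else w)"

definition lift_tl :: "nat \<Rightarrow> (bool list \<Rightarrow> bool list) \<Rightarrow> bool list \<Rightarrow> bool list"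
  where "lift_tl n p w = (if length w = n then hd w # p (tl w) else w)"

text \<open>The rule of \<open>e57\<close> at an inner cell of a row. A row does not wrap around,
  hence the conditions \<open>0 < i\<close> and \<open>Suc i < k\<close> in the lemmas on
  gates.\<close>

definition gate :: "nat \<Rightarrow> nat \<Rightarrow> bool list \<Rightarrow> bool list"
  where "gate k i w = (if length w = k \<and> (w ! (i - 1) \<or> \<not> w ! Suc i) then flip i w else w)"

lemma lift_moves_iff: "lift n k p w \<noteq> w \<longleftrightarrow> length w = n \<and> p (take k w) \<noteq> take k w"
proof -
  have "p (take k w) @ drop k w = w \<longleftrightarrow> p (take k w) @ drop k w = take k w @ drop k w"
    by (simp only: append_take_drop_id)
  also have "\<dots> \<longleftrightarrow> p (take k w) = take k w"
    by (rule append_same_eq)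
  finally show ?thesis by (simp add: lift_def)
qed

lemma lift_tl_moves_iff: "lift_tl (Suc n) p w \<noteq> w \<longleftrightarrow> length w = Suc n \<and> p (tl w) \<noteq> tl w"
  by (cases w) (auto simp: lift_tl_def)

lemma length_permutes_words: "p permutes words k \<Longrightarrow> length w = k \<Longrightarrow> length (p w) = k"
  using permutes_in_image[of p "words k" w] by (simp add: words_def)

lemma permutes_words_fixes: "p permutes words k \<Longrightarrow> length w \<noteq> k \<Longrightarrow> p w = w"
  using permutes_not_in[of p "words k" w] by (simp add: words_def)

lemma lift_permutes:
  assumes p: "p permutes words k" and "k \<le> n"
  shows "lift n k p permutes words n"
proof (rule bij_imp_permutes)
  show "bij_betw (lift n k p) (words n) (words n)"
    by (rule bij_betw_byWitness[where f' = "lift n k (inv' p)"])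
      (use assms length_permutes_words[OF p] length_permutes_words[OF permutes_inv[OF p]] in
        \<open>auto simp: lift_def words_def permutes_inverses[OF p]\<close>)
qed (simp add: lift_def words_def)

lemma lift_tl_permutes:
  assumes p: "p permutes words k"
  shows "lift_tl (Suc k) p permutes words (Suc k)"
proof (rule bij_imp_permutes)
  show "bij_betw (lift_tl (Suc k) p) (words (Suc k)) (words (Suc k))"
    by (rule bij_betw_byWitness[where f' = "lift_tl (Suc k) (inv' p)"])
      (use length_permutes_words[OF p] length_permutes_words[OF permutes_inv[OF p]] in
        \<open>auto simp: lift_tl_def words_def permutes_inverses[OF p] simp flip: length_greater_0_conv\<close>)
qed (simp add: lift_tl_def words_def)

lemma gate_permutes:
  assumes "0 < i" "Suc i < k"
  shows "gate k i permutes words k"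
  by (rule involution_permutes) (use assms in \<open>auto simp: gate_def words_def nth_flip\<close>)

lemma lift_id: "lift n k id = id"
  by (auto simp: lift_def fun_eq_iff)

lemma lift_comp:
  assumes "q permutes words k" "k \<le> n"
  shows "lift n k (p \<circ> q) = lift n k p \<circ> lift n k q"
  using length_permutes_words[OF assms(1)] assms by (auto simp: lift_def fun_eq_iff)

lemma lift_inv:
  assumes p: "p permutes words k" and k: "k \<le> n"
  shows "lift n k (inv' p) = inv' (lift n k p)"
  using lift_comp[OF p k, of "inv' p"] lift_comp[OF permutes_inv[OF p] k, of p]
  by (intro inv_unique_comp[symmetric]) (simp_all only: permutes_inv_o[OF p] lift_id)

lemma lift_self:
  assumes "p permutes words n"
  shows "lift n n p = p"
  using permutes_words_fixes[OF assms] by (auto simp: lift_def fun_eq_iff)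

lemma lift_lift:
  assumes "p permutes words k" "Suc k \<le> n"
  shows "lift n (Suc k) (lift (Suc k) k p) = lift n k p"
proof
  fix w :: "bool list"
  have "drop k (take (Suc k) w) @ drop (Suc k) w = drop k w"
    using append_take_drop_id[of 1 "drop k w"] by (simp only: drop_take drop_drop) simp
  then show "lift n (Suc k) (lift (Suc k) k p) w = lift n k p w"
    using assms by (simp add: lift_def min_def)
qed

text \<open>The shift carries cells \<open>1, ..., k\<close> to cells \<open>0, ..., k - 1\<close>,
  so acting on the offset row is a conjugate of acting on the initial one.\<close>

lemma shift_lift_tl:
  assumes p: "p permutes words k" and k: "Suc k \<le> n"
  shows "shift n \<circ> lift n (Suc k) (lift_tl (Suc k) p) = lift n k p \<circ> shift n"
proof
  fix w :: "bool list"
  show "(shift n \<circ> lift n (Suc k) (lift_tl (Suc k) p)) w = (lift n k p \<circ> shift n) w"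
  proof (cases "length w = n")
    case True
    then obtain a v where w: "w = a # v" using k by (cases w) auto
    have "length (p (take k v)) = k"
      using True k w by (intro length_permutes_words[OF p]) simp
    then show ?thesis
      using True w k by (simp add: shift_def lift_def lift_tl_def words_def)
  qed (simp add: shift_def lift_def words_def)
qed

lemma gate_lift:
  assumes "0 < i" "Suc i < k"
  shows "gate (Suc k) i = lift (Suc k) k (gate k i)"
proof
  fix w :: "bool list"
  show "gate (Suc k) i w = lift (Suc k) k (gate k i) w"
    using assms by (cases w rule: rev_cases)
      (auto simp: gate_def lift_def flip_def nth_append list_update_append)
qed

lemma gate_lift_tl:
  assumes "0 < i" "Suc i < k"
  shows "gate (Suc k) (Suc i) = lift_tl (Suc k) (gate k i)"
proof
  fix w :: "bool list"
  show "gate (Suc k) (Suc i) w = lift_tl (Suc k) (gate k i) w"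
    using assms by (cases w; cases i) (auto simp: gate_def lift_tl_def flip_def)
qed

text \<open>The shift carries cells 0, 1, 2 to cells \<open>n - 1\<close>, 0, 1, where
  \<open>e57\<close> acts.\<close>

lemma shift_gate3:
  assumes "n \<ge> 3"
  shows "shift n \<circ> lift n 3 (gate 3 1) = e57 n \<circ> shift n"
proof
  fix w :: "bool list"
  show "(shift n \<circ> lift n 3 (gate 3 1)) w = (e57 n \<circ> shift n) w"
  proof (cases "length w = n")
    case True
    then obtain a b c v where w: "w = a # b # c # v"
      using assms by (auto simp: numeral_3_eq_3 Suc_le_length_iff)
    then have "n = length v + 3" using True by simp
    then show ?thesis
      unfolding w
      by (simp add: shift_def lift_def gate_def e57_def words_def flip_def nth_append eval_nat_numeral)
  qed (simp add: shift_def lift_def e57_def words_def)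
qed

text \<open>\<open>G\<close> is any permutation group containing the two maps, so that the results
  apply to the group generated by \<open>e57\<close> and also to a conjugate of the one generated by
  \<open>e99\<close>.\<close>

locale e57_group = perm_group "words n" G for n G +
  assumes n: "n \<ge> 4" and e57_mem: "e57 n \<in> G" and shift_mem: "shift n \<in> G"
begin

text \<open>These groups carry the induction on the row length: the first gate appears at
  \<open>k = 3\<close>, and \<open>row n\<close> is \<open>G\<close> itself.\<close>

definition row :: "nat \<Rightarrow> (bool list \<Rightarrow> bool list) set"
  where "row k = {p. p permutes words k \<and> lift n k p \<in> G}"

lemma perm_group_row:
  assumes "k \<le> n"
  shows "perm_group (words k) (row k)"
proof
  show "id \<in> row k"
    using id_mem by (simp only: row_def mem_Collect_eq permutes_id lift_id)
  show "p \<circ> q \<in> row k" if "p \<in> row k" "q \<in> row k" for p q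
    using that assms by (auto simp only: row_def mem_Collect_eq lift_comp intro!: comp_mem permutes_compose)
  show "inv' p \<in> row k" if "p \<in> row k" for p
    using that assms by (simp add: row_def lift_inv inv_mem permutes_inv)
qed (simp add: row_def)

lemma row_n: "row n = G"
  using lift_self permutes by (auto simp: row_def)

lemma mem_if_shift_conj:
  assumes "shift n \<circ> q = p \<circ> shift n" "p \<in> G"
  shows "q \<in> G"
proof -
  have "q = inv' (shift n) \<circ> (p \<circ> shift n)"
    using assms(1)[symmetric] permutes_inv_o(2)[OF shift_permutes] by (simp add: comp_assoc[symmetric])
  then show ?thesis
    using comp_mem inv_mem shift_mem assms(2) by auto
qed

lemma lift_mem_row: "p \<in> row k \<Longrightarrow> Suc k \<le> n \<Longrightarrow> lift (Suc k) k p \<in> row (Suc k)"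
  by (simp add: row_def lift_lift lift_permutes)

lemma lift_tl_mem_row: "p \<in> row k \<Longrightarrow> Suc k \<le> n \<Longrightarrow> lift_tl (Suc k) p \<in> row (Suc k)"
  using mem_if_shift_conj[OF shift_lift_tl] by (simp add: row_def lift_tl_permutes)

text \<open>A gate that is not the rightmost of its row comes from the initial shorter row, the
  rightmost one from the offset shorter row. This descends to the single gate on three cells, a
  conjugate of \<open>e57\<close>.\<close>

lemma gate_mem_row:
  assumes "k \<le> n" "0 < i" "Suc i < k"
  shows "gate k i \<in> row k"
  using assms
proof (induction k arbitrary: i)
  case (Suc k)
  consider "Suc i < k" | "Suc i = k" "i > 1" | "Suc k = 3" "i = 1"
    using Suc.prems by linarith
  then show ?case
  proof cases
    case 1
    then show ?thesis using Suc gate_lift lift_mem_row by simp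
  next
    case 2
    then show ?thesis
      using Suc.IH[of "i - 1"] Suc.prems gate_lift_tl[of "i - 1" k] lift_tl_mem_row by simp
  next
    case 3
    then show ?thesis
      using mem_if_shift_conj[OF shift_gate3 e57_mem] n gate_permutes[of 1 3]
      by (simp add: row_def)
  qed
qed simp

end

subsection \<open>Three-cycles on rows\<close>

lemma length_3_exhaust: "length w = 3 \<longleftrightarrow> (\<exists>a b c. w = [a, b, c])"
  by (auto simp: numeral_3_eq_3 length_Suc_conv)

lemma length_4_exhaust: "length w = 4 \<longleftrightarrow> (\<exists>a b c d. w = [a, b, c, d])"
  by (auto simp: eval_nat_numeral length_Suc_conv)

lemma length_5_exhaust: "length w = 5 \<longleftrightarrow> (\<exists>a b c d e. w = [a, b, c, d, e])"
  by (auto simp: eval_nat_numeral length_Suc_conv)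

text \<open>Between boundary letters 0 and 1, one round of the two gates sends the inner letters 00
  to 10 to 11 to 00 and fixes 01. The fourth power keeps this 3-cycle and is trivial for the other
  boundaries.\<close>

lemma gate_power_eq_cyc3:
  "(gate 4 1 \<circ> gate 4 2) \<circ> (gate 4 1 \<circ> gate 4 2) \<circ> ((gate 4 1 \<circ> gate 4 2) \<circ> (gate 4 1 \<circ> gate 4 2))
    = cyc3 [False, False, False, True] [False, True, False, True] [False, True, True, True]"
proof
  fix w :: "bool list"
  show "((gate 4 1 \<circ> gate 4 2) \<circ> (gate 4 1 \<circ> gate 4 2) \<circ> ((gate 4 1 \<circ> gate 4 2) \<circ> (gate 4 1 \<circ> gate 4 2))) w
    = cyc3 [False, False, False, True] [False, True, False, True] [False, True, True, True] w"
  proof (cases "length w = 4")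
    case True
    then obtain a b c d where "w = [a, b, c, d]" by (auto simp: length_4_exhaust)
    then show ?thesis
      by (cases a; cases b; cases c; cases d) (simp_all add: gate_def flip_def cyc3_def)
  qed (auto simp: gate_def cyc3_def)
qed

section \<open>Linking the words that begin with 0 and end with 1\<close>

context e57_group
begin

lemma cyc3_row_4:
  "cyc3 [False, False, False, True] [False, True, False, True] [False, True, True, True] \<in> row 4"
proof -
  interpret row: perm_group "words 4" "row 4"
    by (rule perm_group_row) (rule n)
  have "gate 4 1 \<in> row 4" "gate 4 2 \<in> row 4"
    using n by (auto intro!: gate_mem_row)
  then show ?thesis
    unfolding gate_power_eq_cyc3[symmetric] by (intro row.comp_mem)
qed

text \<open>Other boundary letters have to be excluded: for instance, on four cells with boundary
  letters 1 and 0 the gates generate only a Klein four-group.\<close>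

definition row_linked :: "nat \<Rightarrow> bool"
  where "row_linked k \<longleftrightarrow> (\<forall>u v. length u = k - 2 \<longrightarrow> length v = k - 2
    \<longrightarrow> linked (row k) (False # u @ [True]) (False # v @ [True]))"

text \<open>Both gates on four cells fix 0011, so the 3-cycle of \<open>cyc3_row_4\<close> and these
  gates do not link all words 0ab1. The induction starts with five cells.\<close>

lemma row_linked_5:
  assumes "n \<ge> 5"
  shows "row_linked 5"
proof -
  interpret row: perm_group "words 5" "row 5"
    by (rule perm_group_row) (rule assms)
  let ?c = "cyc3 [False, False, False, True] [False, True, False, True] [False, True, True, True]"
  \<comment> \<open>The two copies of \<open>?c\<close> on cells \<open>0, ..., 3\<close> and \<open>1, ..., 4\<close> have no common moved
    point; conjugating the first one by the gates creates exactly one.\<close>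
  let ?g = "gate 5 1 \<circ> gate 5 2 \<circ> gate 5 3 \<circ> lift 5 4 ?c \<circ> (gate 5 3 \<circ> gate 5 2 \<circ> gate 5 1)"
  let ?h = "lift_tl 5 ?c"
  let ?z = "[False, False, False, False, True]"
  have gates: "gate 5 1 \<in> row 5" "gate 5 2 \<in> row 5" "gate 5 3 \<in> row 5"
    using assms by (auto intro!: gate_mem_row)
  have h: "?h \<in> row 5"
    using lift_tl_mem_row[OF cyc3_row_4] assms by simp
  have "lift 5 4 ?c \<in> row 5"
    using lift_mem_row[OF cyc3_row_4] assms by simp
  then have g: "?g \<in> row 5"
    using gates by (intro row.comp_mem)
  have z: "?g w \<noteq> w \<and> ?h w \<noteq> w \<longleftrightarrow> w = ?z" for w
  proof (cases "length w = 5")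
    case True
    then obtain a b c d e where "w = [a, b, c, d, e]" by (auto simp: length_5_exhaust)
    then show ?thesis
      by (cases a; cases b; cases c; cases d; cases e)
        (simp_all add: gate_def flip_def cyc3_def lift_def lift_tl_def)
  qed (auto simp: gate_def lift_def)
  let ?r = "linked (row 5)"
  note eval = gate_def flip_def cyc3_def lift_def lift_tl_def
  have 1: "?r ?z [False, True, False, True, True]" and 2: "?r ?z [False, False, True, False, True]"
    using row.linked_commutator[OF g h z] by (simp_all add: eval)
  \<comment> \<open>Images under the gates spread the two links to the remaining five words
    0abc1.\<close>
  have 3: "?r [False, True, False, False, True] [False, False, False, True, True]"
    using row.linked_image[OF gates(1) 1] by (simp add: eval)
  have 4: "?r [False, True, False, False, True] [False, False, True, False, True]"
    using row.linked_image[OF gates(1) 2] by (simp add: eval)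
  have 5: "?r [False, False, True, False, True] [False, True, True, True, True]"
    using row.linked_image[OF gates(2) 1] by (simp add: eval)
  have 6: "?r ?z [False, False, True, True, True]"
    using row.linked_image[OF gates(3) 2] by (simp add: eval)
  have 7: "?r [False, True, True, False, True] ?z"
    using row.linked_image[OF gates(2) 4] by (simp add: eval)
  have 8: "?r ?z [False, True, False, False, True]"
    using row.linked_trans[OF 2 row.linked_sym[OF 4]] .
  have all: "?r ?z [False, a, b, c, True]" for a b c
    using 1 2 6 row.linked_sym[OF 7] 8 row.linked_trans[OF 8 3] row.linked_trans[OF 2 5]
      row.linked_refl[of ?z]
    by (cases a; cases b; cases c) simp_all
  show ?thesis
    using row.linked_trans[OF row.linked_sym[OF all] all]
    by (auto simp: row_linked_def length_3_exhaust)
qed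

lemma row_linked_cyc3:
  assumes "k \<le> n" "row_linked k"
    and "length u + 2 = k" "length v + 2 = k" "length w + 2 = k" "distinct [u, v, w]"
  shows "cyc3 (False # u @ [True]) (False # v @ [True]) (False # w @ [True]) \<in> row k"
proof -
  interpret row: perm_group "words k" "row k"
    by (rule perm_group_row) (rule assms)
  have "length u = k - 2" "length v = k - 2" "length w = k - 2"
    using assms by auto
  with assms show ?thesis
    by (intro row.cyc3_mem_if_linked) (auto simp: row_linked_def)
qed

text \<open>Use a 3-cycle on the first \<open>k\<close> cells through 00y1 and two words beginning
  with 01, and one on the last \<open>k\<close> cells through 0y11, 0v1 and a third word. A word
  moved by both has second letter 0 and last letter 1, so it is 00y11, and
  \<open>linked_commutator\<close> applies.\<close>

lemma row_linked_overlap: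
  assumes k: "4 \<le> k" "Suc k \<le> n" and "row_linked k"
    and y: "length y + 3 = k" and x: "length x + 3 = k" and v: "length v + 2 = k"
  shows "linked (row (Suc k)) (False # False # y @ [True, True]) (False # True # x @ [True, True])"
    and "linked (row (Suc k)) (False # False # y @ [True, True]) (False # False # v @ [True])"
proof -
  interpret row: perm_group "words (Suc k)" "row (Suc k)"
    by (rule perm_group_row) (rule k)
  let ?z = "False # False # y @ [True, True]"
  have "k = Suc (Suc (Suc (length y)))"
    using y by simp
  then have take_z: "take k ?z = False # False # y @ [True]" "drop k ?z = [True]"
    by simp_all
  have links: "linked (row (Suc k)) ?z (False # True # x @ [True, True])
    \<and> linked (row (Suc k)) ?z (False # False # v @ [True])"
    if v: "length v + 2 = k" "v \<noteq> y @ [True]" for v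
  proof -
    define x' where "x' = flip 0 x"
    have "x \<noteq> []"
      using x k by auto
    then have x': "length x' + 3 = k" "x' \<noteq> x"
      using x k nth_flip[of 0 x 0] by (auto simp: x'_def)
    \<comment> \<open>At most one of the two flips of \<open>v\<close> equals
      \<open>y @ [True]\<close>; the other supplies the third word of the second 3-cycle.\<close>
    have "flip 0 v ! 0 \<noteq> v ! 0" "flip 1 v ! 0 = v ! 0" "flip 1 v ! 1 \<noteq> v ! 1"
    proof -
      have "0 < length v" "1 < length v"
        using v(1) k by linarith+
      then show "flip 0 v ! 0 \<noteq> v ! 0" "flip 1 v ! 0 = v ! 0" "flip 1 v ! 1 \<noteq> v ! 1"
        by (simp_all add: nth_flip del: One_nat_def)
    qed
    then have "flip 0 v \<noteq> flip 1 v" "flip 0 v \<noteq> v" "flip 1 v \<noteq> v"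
      by metis+
    then have "\<exists>v' \<in> {flip 0 v, flip 1 v}. v' \<noteq> v \<and> v' \<noteq> y @ [True]"
      by auto
    then obtain v' where "v' \<in> {flip 0 v, flip 1 v}" "v' \<noteq> v" "v' \<noteq> y @ [True]"
      by blast
    then have v': "length v' + 2 = k" "v' \<noteq> v" "v' \<noteq> y @ [True]"
      using v(1) by auto
    let ?p = "cyc3 (False # (False # y) @ [True]) (False # (True # x) @ [True]) (False # (True # x') @ [True])"
    let ?q = "cyc3 (False # (y @ [True]) @ [True]) (False # v @ [True]) (False # v' @ [True])"
    have p: "?p \<in> row k"
      using x y x' k by (intro row_linked_cyc3 \<open>row_linked k\<close>) auto
    have q: "?q \<in> row k"
      using y v v' k by (intro row_linked_cyc3 \<open>row_linked k\<close>) auto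
    have lp: "lift (Suc k) k ?p w \<noteq> w \<longleftrightarrow> length w = Suc k
      \<and> take k w \<in> {False # False # y @ [True], False # True # x @ [True], False # True # x' @ [True]}" for w
      unfolding lift_moves_iff using x' by (subst cyc3_moves_iff) auto
    have lq: "lift_tl (Suc k) ?q w \<noteq> w \<longleftrightarrow> length w = Suc k
      \<and> tl w \<in> {False # y @ [True, True], False # v @ [True], False # v' @ [True]}" for w
      unfolding lift_tl_moves_iff using v v' by (subst cyc3_moves_iff) auto
    have z: "lift (Suc k) k ?p w \<noteq> w \<and> lift_tl (Suc k) ?q w \<noteq> w \<longleftrightarrow> w = ?z" for w
    proof
      assume "lift (Suc k) k ?p w \<noteq> w \<and> lift_tl (Suc k) ?q w \<noteq> w"
      then have len: "length w = Suc k"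
        and "take k w \<in> {False # False # y @ [True], False # True # x @ [True], False # True # x' @ [True]}"
        and tl: "tl w \<in> {False # y @ [True, True], False # v @ [True], False # v' @ [True]}"
        unfolding lp lq by auto
      then obtain t b where t: "w = t @ [b]" "length t = k"
          "t \<in> {False # False # y @ [True], False # True # x @ [True], False # True # x' @ [True]}"
        by (cases w rule: rev_cases) auto
      have "hd (tl w) = False" "last (tl w) = True"
        using tl by auto
      then show "w = ?z"
        using t by auto
    next
      assume "w = ?z"
      then show "lift (Suc k) k ?p w \<noteq> w \<and> lift_tl (Suc k) ?q w \<noteq> w"
        unfolding lp lq using y take_z by auto
    qed
    have "lift (Suc k) k ?p ?z = False # True # x @ [True, True]"
      using y take_z by (simp add: lift_def cyc3_def)
    moreover have "lift_tl (Suc k) ?q ?z = False # False # v @ [True]"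
      using y v by (auto simp: lift_tl_def cyc3_def)
    ultimately show ?thesis
      using row.linked_commutator[OF lift_mem_row[OF p k(2)] lift_tl_mem_row[OF q k(2)] z] by simp
  qed
  show "linked (row (Suc k)) ?z (False # False # v @ [True])"
    using links[of v] v by (cases "v = y @ [True]") auto
  \<comment> \<open>Any word of the right length other than \<open>y @ [True]\<close> serves for the
    second 3-cycle here.\<close>
  show "linked (row (Suc k)) ?z (False # True # x @ [True, True])"
    using links[of "y @ [False]"] y by simp
qed

text \<open>\<open>row_linked_overlap\<close> reaches all words 00v1 and 01x11. The remaining words
  01x01 are tied to 01x11 in \<open>F\<close>, by applying gates to a link between two words
  beginning with 000.\<close>

lemma row_linked_Suc:
  assumes k: "4 \<le> k" "Suc k \<le> n" and "row_linked k"
  shows "row_linked (Suc k)"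
proof -
  interpret row: perm_group "words (Suc k)" "row (Suc k)"
    by (rule perm_group_row) (rule k)
  let ?r = "linked (row (Suc k))"
  note overlap = row_linked_overlap[OF assms]
  define y where "y = replicate (k - 3) False"
  let ?z = "False # False # y @ [True, True]"
  have y: "length y + 3 = k"
    using k by (simp add: y_def)
  have gates: "gate (Suc k) 1 \<in> row (Suc k)" "gate (Suc k) 2 \<in> row (Suc k)"
    using k by (auto intro!: gate_mem_row)
  have F: "?r (False # True # x @ [False, True]) (False # True # x @ [True, True])"
    if x: "length x + 3 = k" for x
  proof -
    obtain a x' where x': "x = a # x'"
      using x k by (cases x) auto
    have "?r (False # False # (False # x' @ [False]) @ [True]) (False # False # (False # x' @ [True]) @ [True])"
      using row.linked_trans[OF row.linked_sym[OF overlap(2)[OF y y]] overlap(2)[OF y y],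
          of "False # x' @ [False]" "False # x' @ [True]"] x x' by simp
    \<comment> \<open>Cell 2 holds 0, so the gate at cell 1 flips in both words.\<close>
    from row.linked_image[OF gates(1) this]
    have *: "?r (False # True # False # x' @ [False, True]) (False # True # False # x' @ [True, True])"
      using x x' by (simp add: gate_def flip_def)
    show ?thesis
    proof (cases a)
      \<comment> \<open>Cell 1 now holds 1, so the gate at cell 2 turns the first letter of
        \<open>x\<close> into 1.\<close>
      case True
      then show ?thesis
        using row.linked_image[OF gates(2) *] x x' by (simp add: gate_def flip_def eval_nat_numeral)
    qed (use * x' in simp)
  qed
  have all: "?r ?z (False # u @ [True])" if l: "length u + 1 = k" for u
  proof -
    obtain a v where u: "u = a # v" "length v + 2 = k"
      using l k by (cases u) auto
    then obtain x b where v: "v = x @ [b]" "length x + 3 = k"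
      using k by (cases v rule: rev_cases) auto
    show ?thesis
    proof (cases a)
      case True
      have 1: "?r ?z (False # True # x @ [True, True])"
        by (rule overlap(1)[OF y v(2) u(2)])
      show ?thesis
        using True 1 row.linked_trans[OF 1 row.linked_sym[OF F[OF v(2)]]] u v by (cases b) simp_all
    next
      case False
      then show ?thesis
        using overlap(2)[OF y y u(2)] u by simp
    qed
  qed
  show ?thesis
    unfolding row_linked_def using row.linked_trans[OF row.linked_sym[OF all] all] k by auto
qed

lemma row_linked_n:
  assumes "n \<ge> 5"
  shows "row_linked n"
proof -
  have "row_linked k" if "5 \<le> k" "k \<le> n" for k
    using that
  proof (induction k rule: dec_induct)
    case base
    show ?case by (rule row_linked_5) (rule assms)
  next
    case (step k)
    then show ?case by (intro row_linked_Suc) auto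
  qed
  then show ?thesis using assms by simp
qed

end

subsection \<open>The generated groups\<close>

text \<open>A word without the factor 10 is sorted. Words with this factor are rotations of words
  0u1, cut open between the 1 and the 0.\<close>

lemma bool_list_cases:
  obtains x y where "w = x @ True # False # y"
    | i j where "w = replicate i False @ replicate j True"
proof (induction w arbitrary: thesis)
  case Nil
  then show ?case by (metis append_Nil replicate_0)
next
  case (Cons a w)
  show ?case
  proof (rule Cons.IH)
    fix x y
    assume "w = x @ True # False # y"
    then have "a # w = (a # x) @ True # False # y" by simp
    then show thesis by (rule Cons.prems(1))
  next
    fix i j
    assume w: "w = replicate i False @ replicate j True"
    consider "\<not> a" | "a" "i = 0" | i' where "a" "i = Suc i'"
      by (cases i) auto
    then show thesis
    proof cases
      case 1
      then have "a # w = replicate (Suc i) False @ replicate j True" using w by simp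
      then show thesis by (rule Cons.prems(2))
    next
      case 2
      then have "a # w = replicate 0 False @ replicate (Suc j) True" using w by simp
      then show thesis by (rule Cons.prems(2))
    next
      case 3
      then have "a # w = [] @ True # False # replicate i' False @ replicate j True" using w by simp
      then show thesis by (rule Cons.prems(1))
    qed
  qed
qed

section \<open>Linking all words of length \<open>n\<close>\<close>

context e57_group
begin

lemma e57_apply:
  "length u + 3 = n \<Longrightarrow>
    e57 n (a # b # u @ [c]) = (if c \<or> \<not> b then (\<not> a) # b # u @ [c] else a # b # u @ [c])"
  by (auto simp: e57_def words_def nth_append nth_Cons')

lemma shift_apply: "length w = n \<Longrightarrow> shift n w = rotate1 w"
  by (simp add: shift_def words_def)

lemma linked_shift: "length v = n \<Longrightarrow> length w = n \<Longrightarrow> linked G v w \<Longrightarrow> linked G (rotate1 v) (rotate1 w)"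
  using linked_image[OF shift_mem, of v w] by (simp add: shift_apply)

text \<open>The induction on rows begins at five cells, so this case is done by hand, spreading the
  links of the 3-cycle by shifts and gates. The numbers in \<open>r1_5\<close> and the like are the
  two words read in binary.\<close>

lemma linked_all_4:
  assumes "n = 4" "length v = n" "length w = n"
  shows "linked G v w"
proof -
  let ?r = "linked G"
  have gates: "gate 4 1 \<in> G" "gate 4 2 \<in> G"
    using gate_mem_row[of n] row_n assms(1) by auto
  have c: "cyc3 [False, False, False, True] [False, True, False, True] [False, True, True, True] \<in> G"
    using cyc3_row_4 row_n assms(1) by auto
  note shift = linked_shift[unfolded assms(1)]
  note eval = gate_def flip_def e57_def words_def
  have r1_5: "?r [False, False, False, True] [False, True, False, True]"
    using linked_cyc3[OF _ c] by simp
  have "cyc3 [False, True, False, True] [False, True, True, True] [False, False, False, True] \<in> G"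
    using c cyc3_rotate[of "[False, False, False, True]" "[False, True, False, True]" "[False, True, True, True]"] by simp
  then have r5_7: "?r [False, True, False, True] [False, True, True, True]"
    by (rule linked_cyc3[rotated]) simp
  have r2_10: "?r [False, False, True, False] [True, False, True, False]"
    using shift[OF _ _ r1_5] assms(1) by simp
  have r4_5: "?r [False, True, False, False] [False, True, False, True]"
    using shift[OF _ _ r2_10] assms(1) by simp
  have r8_10: "?r [True, False, False, False] [True, False, True, False]"
    using shift[OF _ _ r4_5] assms(1) by simp
  have r10_14: "?r [True, False, True, False] [True, True, True, False]"
    using shift[OF _ _ r5_7] assms(1) by simp
  have r5_13: "?r [False, True, False, True] [True, True, False, True]"
    using shift[OF _ _ r10_14] assms(1) by simp
  have r10_11: "?r [True, False, True, False] [True, False, True, True]"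
    using shift[OF _ _ r5_13] assms(1) by simp
  have r1_4: "?r [False, False, False, True] [False, True, False, False]"
    using linked_trans[OF r1_5 linked_sym[OF r4_5]] .
  have r5_0: "?r [False, True, False, True] [False, False, False, False]"
    using linked_image[OF gates(1) r1_4] by (simp add: eval)
  have r6_7: "?r [False, True, True, False] [False, True, True, True]"
    using linked_image[OF gates(2) r4_5] by (simp add: eval)
  have r0_1: "?r [False, False, False, False] [False, False, False, True]"
    using linked_sym[OF linked_trans[OF r1_5 r5_0]] .
  have r0_2: "?r [False, False, False, False] [False, False, True, False]"
    using shift[OF _ _ r0_1] assms(1) by simp
  have r0_4: "?r [False, False, False, False] [False, True, False, False]"
    using shift[OF _ _ r0_2] assms(1) by simp
  have r0_8: "?r [False, False, False, False] [True, False, False, False]"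
    using shift[OF _ _ r0_4] assms(1) by simp
  have r0_5: "?r [False, False, False, False] [False, True, False, True]"
    using linked_sym[OF r5_0] .
  have r0_10: "?r [False, False, False, False] [True, False, True, False]"
    using shift[OF _ _ r0_5] assms(1) by simp
  have r0_7: "?r [False, False, False, False] [False, True, True, True]"
    using linked_trans[OF r0_5 r5_7] .
  have r0_14: "?r [False, False, False, False] [True, True, True, False]"
    using shift[OF _ _ r0_7] assms(1) by simp
  have r0_13: "?r [False, False, False, False] [True, True, False, True]"
    using shift[OF _ _ r0_14] assms(1) by simp
  have r0_11: "?r [False, False, False, False] [True, False, True, True]"
    using shift[OF _ _ r0_13] assms(1) by simp
  have r0_6: "?r [False, False, False, False] [False, True, True, False]"
    using linked_trans[OF r0_7 linked_sym[OF r6_7]] .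
  have r0_12: "?r [False, False, False, False] [True, True, False, False]"
    using shift[OF _ _ r0_6] assms(1) by simp
  have r0_9: "?r [False, False, False, False] [True, False, False, True]"
    using shift[OF _ _ r0_12] assms(1) by simp
  have r0_3: "?r [False, False, False, False] [False, False, True, True]"
    using shift[OF _ _ r0_9] assms(1) by simp
  \<comment> \<open>The shift fixes 1111, so it has to be reached by a flip of 0111; the same flip
    sends 1000 to 0000.\<close>
  have r8_7: "?r [True, False, False, False] [False, True, True, True]"
    using linked_trans[OF linked_sym[OF r0_8] r0_7] .
  have r0_15: "?r [False, False, False, False] [True, True, True, True]"
    using linked_image[OF e57_mem r8_7] assms(1) by (simp add: eval)
  have all: "?r [False, False, False, False] w" if "length w = n" for w
  proof -
    have "\<exists>a b c d. w = [a, b, c, d]"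
      using that assms(1) length_4_exhaust[of w] by blast
    then obtain a b c d where "w = [a, b, c, d]" by blast
    then show ?thesis
      using linked_refl[of "[False, False, False, False]"] r0_1 r0_2 r0_3 r0_4 r0_5 r0_6 r0_7 r0_8 r0_9 r0_10 r0_11 r0_12 r0_13 r0_14 r0_15
      by (cases a; cases b; cases c; cases d) simp_all
  qed
  show ?thesis
    using linked_trans[OF linked_sym[OF all] all] assms(2,3) by blast
qed

text \<open>All words 0u1 are linked to each other and to their rotations, which covers every word
  with a factor 10. Sorted words are of the form 0u1 or constant, and the constant ones are one
  application of \<open>e57\<close> away.\<close>

lemma linked_all:
  assumes "length v = n" "length w = n"
  shows "linked G v w"
proof (cases "n = 4")
  case True
  then show ?thesis using assms by (intro linked_all_4)
next
  case False
  with n have n5: "n \<ge> 5" by simp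
  let ?r = "linked G"
  have inner: "?r (False # u @ [True]) (False # v @ [True])" if "length u + 2 = n" "length v + 2 = n" for u v
    using row_linked_n[OF n5] row_n that by (auto simp: row_linked_def)
  \<comment> \<open>Shifting by 2 or by 3 can map a word of the form \<open>0u1\<close> to another such word, shifting by 1
    cannot.\<close>
  have rot2: "?r (False # u @ [True]) (rotate1 (rotate1 (False # u @ [True])))"
    if u: "length u + 2 = n" for u
  proof -
    define x where "x = replicate (n - 4) False"
    have x: "length x + 4 = n" using n by (simp add: x_def)
    have 1: "?r (False # u @ [True]) (False # (True # False # x) @ [True])"
      using u x by (intro inner) auto
    have "?r (rotate1 (rotate1 (False # u @ [True]))) (rotate1 (rotate1 (False # (True # False # x) @ [True])))"
      using u x by (intro linked_shift 1) auto
    moreover have "rotate1 (rotate1 (False # (True # False # x) @ [True])) = False # (x @ [True, False]) @ [True]"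
      by simp
    moreover have "?r (False # u @ [True]) (False # (x @ [True, False]) @ [True])"
      using u x by (intro inner) auto
    ultimately show ?thesis
      by (metis linked_sym linked_trans)
  qed
  have rot3: "?r (False # u @ [True]) (rotate1 (rotate1 (rotate1 (False # u @ [True]))))"
    if u: "length u + 2 = n" for u
  proof -
    define x where "x = replicate (n - 5) False"
    have x: "length x + 5 = n" using n5 by (simp add: x_def)
    have 1: "?r (False # u @ [True]) (False # (False # True # False # x) @ [True])"
      using u x by (intro inner) auto
    have "?r (rotate1 (rotate1 (rotate1 (False # u @ [True]))))
      (rotate1 (rotate1 (rotate1 (False # (False # True # False # x) @ [True]))))"
      using u x by (intro linked_shift 1) auto
    moreover have "rotate1 (rotate1 (rotate1 (False # (False # True # False # x) @ [True])))
        = False # (x @ [True, False, False]) @ [True]"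
      by simp
    moreover have "?r (False # u @ [True]) (False # (x @ [True, False, False]) @ [True])"
      using u x by (intro inner) auto
    ultimately show ?thesis
      by (metis linked_sym linked_trans)
  qed
  \<comment> \<open>The shift of the link from \<open>rot2\<close> joins the rotations by 1 and by
    3, and \<open>rot3\<close> joins the latter to the word itself.\<close>
  have rot1: "?r (False # u @ [True]) (rotate1 (False # u @ [True]))" if u: "length u + 2 = n" for u
    using linked_trans[OF rot3[OF u] linked_sym[OF linked_shift[OF _ _ rot2[OF u]]]] u by simp
  have rot: "?r (False # u @ [True]) (rotate m (False # u @ [True]))" if u: "length u + 2 = n" for u m
  proof (induction m)
    case (Suc m)
    have "?r (rotate1 (False # u @ [True])) (rotate1 (rotate m (False # u @ [True])))"
      using u by (intro linked_shift Suc) auto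
    then show ?case
      using linked_trans[OF rot1[OF u]] by simp
  qed simp
  define x where "x = replicate (n - 4) False"
  have x: "length x + 4 = n" using n by (simp add: x_def)
  let ?z = "False # (True # False # x) @ [True]"
  have descent: "?r ?z w" if "length w = n" "w = s @ True # False # t" for w s t
  proof -
    have "?r ?z (False # (t @ s) @ [True])"
      using x that by (intro inner) auto
    moreover have "?r (False # (t @ s) @ [True]) (rotate (length (False # t)) (False # (t @ s) @ [True]))"
      using that by (intro rot) auto
    moreover have "rotate (length (False # t)) (False # (t @ s) @ [True]) = w"
      using rotate_append[of "False # t" "s @ [True]"] that by simp
    ultimately show ?thesis
      using linked_trans by simp
  qed
  \<comment> \<open>This image has a factor 10, so it is linked to \<open>?z\<close>, and hence the
    class of \<open>?z\<close> is closed under \<open>e57 n\<close>.\<close>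
  have "e57 n ?z = True # True # False # x @ [True]"
    using e57_apply[of "False # x" False True True] x by simp
  then have "?r ?z (e57 n ?z)"
    using descent[of "e57 n ?z" "[True]" "x @ [True]"] x by simp
  then have e57: "?r ?z (e57 n w)" if "?r ?z w" for w
    using linked_trans[OF _ linked_image[OF e57_mem that]] by simp
  have all: "?r ?z w" if w: "length w = n" for w
  proof (cases w rule: bool_list_cases)
    case (1 s t)
    then show ?thesis using descent w by simp
  next
    case (2 i j)
    define m where "m = n - 3"
    have m: "m + 3 = n" using n by (simp add: m_def)
    consider (zeros) "j = 0" "i = n" | (ones) "i = 0" "j = n" | (mixed) i' j' where "i = Suc i'" "j = Suc j'"
      using 2 w by (cases i; cases j) auto
    then show ?thesis
    proof cases
      case zeros
      have "?r ?z (True # False # replicate m False @ [False])"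
        using m by (intro descent[of _ "[]" "replicate m False @ [False]"]) auto
      from e57[OF this] have "?r ?z (False # False # replicate m False @ [False])"
        using m by (simp add: e57_apply)
      moreover have "w = False # False # replicate m False @ [False]"
        using zeros 2 m by (simp add: replicate_append_same eval_nat_numeral flip: m)
      ultimately show ?thesis by simp
    next
      case ones
      have "?r ?z (False # (True # replicate m True) @ [True])"
        using m x by (intro inner) auto
      from e57[OF this] have "?r ?z (True # True # replicate m True @ [True])"
        using m by (simp add: e57_apply)
      moreover have "w = True # True # replicate m True @ [True]"
        using ones 2 m by (simp add: replicate_append_same eval_nat_numeral flip: m)
      ultimately show ?thesis by simp
    next
      case mixed
      then have "w = False # (replicate i' False @ replicate j' True) @ [True]"
        using 2 by (simp add: replicate_append_same)
      moreover have "?r ?z (False # (replicate i' False @ replicate j' True) @ [True])"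
        using w x 2 mixed by (intro inner) auto
      ultimately show ?thesis by simp
    qed
  qed
  show ?thesis
    using linked_trans[OF linked_sym[OF all] all] assms by blast
qed

lemma even_mem_G:
  assumes even: "\<And>p. p \<in> G \<Longrightarrow> evenperm p" and p: "p permutes words n" "evenperm p"
  shows "p \<in> G"
  by (rule even_mem[OF finite_words _ even p]) (auto simp: words_def intro: linked_all)

end

section \<open>Complementing all letters\<close>

definition compl :: "nat \<Rightarrow> bool list \<Rightarrow> bool list"
  where "compl n w = (if length w = n then map Not w else w)"

lemma compl_compl: "compl n \<circ> compl n = id"
  by (auto simp: compl_def fun_eq_iff comp_def)

lemma inv_compl: "inv' (compl n) = compl n"
  by (rule inv_unique_comp; rule compl_compl)

lemma compl_permutes: "compl n permutes words n"
  by (rule involution_permutes) (auto simp: compl_def words_def comp_def)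

lemma compl_shift_compl: "compl n \<circ> shift n \<circ> compl n = shift n"
  by (auto simp: compl_def shift_def words_def fun_eq_iff rotate1_map comp_def)

lemma compl_e57_compl:
  assumes "n \<ge> 2"
  shows "compl n \<circ> e57 n \<circ> compl n = e99 n"
  using assms by (auto simp: compl_def e57_def e99_def words_def fun_eq_iff map_update comp_def)

lemma evenperm_e99:
  assumes "n \<ge> 4"
  shows "evenperm (e99 n)"
  using evenperm_conj[OF finite_words compl_permutes e57_permutes, of n] evenperm_e57[OF assms] assms
  by (simp add: inv_compl flip: compl_e57_compl)

section \<open>Generated subgroups of the symmetric group\<close>

lemma inv_sym_group_on:
  assumes "p permutes S"
  shows "inv\<^bsub>sym_group_on S\<^esub> p = inv' p"
proof -
  interpret group "sym_group_on S"
    by (rule group_sym_group_on)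
  show ?thesis
    by (rule inv_equality)
      (use permutes_inv[OF assms] permutes_inv_o(2)[OF assms] assms in \<open>auto simp: sym_group_on_def\<close>)
qed

lemma perm_group_generate:
  assumes "\<And>p. p \<in> A \<Longrightarrow> p permutes S"
  shows "perm_group S (generate (sym_group_on S) A)"
proof
  have A: "A \<subseteq> carrier (sym_group_on S)"
    using assms by (auto simp: sym_group_on_def)
  note sub = group.generate_is_subgroup[OF group_sym_group_on A]
  show perm: "p permutes S" if "p \<in> generate (sym_group_on S) A" for p
    using subgroup.mem_carrier[OF sub that] by (simp add: sym_group_on_def)
  show "id \<in> generate (sym_group_on S) A"
    using subgroup.one_closed[OF sub] by (simp add: sym_group_on_def)
  show "p \<circ> q \<in> generate (sym_group_on S) A"
    if "p \<in> generate (sym_group_on S) A" "q \<in> generate (sym_group_on S) A" for p q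
    using subgroup.m_closed[OF sub that] by (simp add: sym_group_on_def)
  show "inv' p \<in> generate (sym_group_on S) A" if "p \<in> generate (sym_group_on S) A" for p
    using subgroup.m_inv_closed[OF sub that] inv_sym_group_on[OF perm[OF that]] by simp
qed

lemma generate_even:
  assumes "finite S" and A: "\<And>p. p \<in> A \<Longrightarrow> p permutes S" "\<And>p. p \<in> A \<Longrightarrow> evenperm p"
    and "p \<in> generate (sym_group_on S) A"
  shows "p permutes S \<and> evenperm p"
  using assms(4)
proof (induction rule: generate.induct)
  case one
  show ?case by (simp only: sym_group_on_def monoid.simps permutes_id evenperm_id)
next
  case (incl p)
  then show ?case using A by simp
next
  case (inv p)
  then have p: "p permutes S" "evenperm p"
    using A by auto
  moreover have "permutation p"
    using p \<open>finite S\<close> by (auto simp: permutation_permutes)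
  ultimately show ?case
    using permutes_inv[OF p(1)] by (simp add: inv_sym_group_on evenperm_inv)
next
  case (eng p q)
  moreover have "permutation p" "permutation q"
    using eng \<open>finite S\<close> by (auto simp: permutation_permutes)
  ultimately show ?case
    using permutes_compose[of q S p] evenperm_comp[of p q] by (simp only: sym_group_on_def monoid.simps simp_thms)
qed

lemma alt_group_eq_generate:
  assumes perm: "\<And>p. p \<in> A \<Longrightarrow> p permutes words n" and even: "\<And>p. p \<in> A \<Longrightarrow> evenperm p"
    and mem: "\<And>p. p permutes words n \<Longrightarrow> evenperm p \<Longrightarrow> p \<in> generate (sym_group_on (words n)) A"
  shows "carrier (alt_group_on (words n)) = generate (sym_group_on (words n)) A"
  using generate_even[OF finite_words perm even] mem by (auto simp: alt_group_on_def)

theorem corollary1: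
  fixes n :: nat
  assumes "n \<ge> 4"
  shows "carrier (alt_group_on (words n)) = generate (sym_group_on (words n)) {e57 n, shift n}
    \<and> carrier (alt_group_on (words n)) = generate (sym_group_on (words n)) {e99 n, shift n}"
proof
  have n: "n \<ge> 2" "n \<ge> 3" using assms by auto
  let ?gen = "\<lambda>f. generate (sym_group_on (words n)) {f, shift n}"
  have perm57: "p permutes words n" "evenperm p" if "p \<in> {e57 n, shift n}" for p
    using that e57_permutes[OF n(1)] shift_permutes evenperm_e57[OF assms] evenperm_shift[OF n(2)] by auto
  have perm99: "p permutes words n" "evenperm p" if "p \<in> {e99 n, shift n}" for p
    using that e99_permutes[OF n(1)] shift_permutes evenperm_e99[OF assms] evenperm_shift[OF n(2)] by auto
  have even57: "evenperm p" if "p \<in> ?gen (e57 n)" for p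
    using generate_even[OF finite_words perm57 that] by blast
  have even99: "evenperm p" if "p \<in> ?gen (e99 n)" for p
    using generate_even[OF finite_words perm99 that] by blast
  show "carrier (alt_group_on (words n)) = ?gen (e57 n)"
  proof (rule alt_group_eq_generate[OF perm57])
    interpret perm_group "words n" "?gen (e57 n)"
      by (rule perm_group_generate[OF perm57(1)])
    interpret e57_group n "?gen (e57 n)"
      by unfold_locales (auto intro: assms generate.incl)
    show "p \<in> ?gen (e57 n)" if "p permutes words n" "evenperm p" for p
      by (rule even_mem_G[OF even57 that])
  qed
  show "carrier (alt_group_on (words n)) = ?gen (e99 n)"
  proof (rule alt_group_eq_generate[OF perm99])
    interpret gen: perm_group "words n" "?gen (e99 n)"
      by (rule perm_group_generate[OF perm99(1)])
    define c where "c p = compl n \<circ> p \<circ> compl n" for p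
    have c_comp: "c (p \<circ> q) = c p \<circ> c q" for p q
      using compl_compl[of n] by (auto simp: c_def fun_eq_iff)
    have c_c: "c (c p) = p" for p
      using compl_compl[of n] by (auto simp: c_def fun_eq_iff)
    have c_id: "c id = id"
      using compl_compl[of n] by (simp add: c_def)
    have c_perm: "c p permutes words n" if "p permutes words n" for p
      unfolding c_def by (intro permutes_compose compl_permutes that)
    have c_inv: "c (inv' p) = inv' (c p)" if "p permutes words n" for p
      using permutes_inv_o[OF that]
      by (intro inv_unique_comp[symmetric]) (simp_all only: c_comp[symmetric] c_id)
    have c_even: "evenperm (c p) = evenperm p" if "p permutes words n" for p
      using evenperm_conj[OF finite_words compl_permutes that] by (simp only: c_def inv_compl)
    \<comment> \<open>The conjugate by \<open>compl n\<close> of the group generated by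
      \<open>e99\<close> and the shift. It contains \<open>e57\<close> and the shift, hence all even
      permutations, and conjugating back preserves parity.\<close>
    let ?G = "{p. c p \<in> ?gen (e99 n)}"
    interpret perm_group "words n" ?G
    proof
      show perm: "p permutes words n" if "p \<in> ?G" for p
        using c_perm[OF gen.permutes, of "c p"] that by (simp add: c_c)
      show "id \<in> ?G"
        using gen.id_mem by (simp only: mem_Collect_eq c_id)
      show "p \<circ> q \<in> ?G" if "p \<in> ?G" "q \<in> ?G" for p q
        using that gen.comp_mem by (simp only: mem_Collect_eq c_comp)
      show "inv' p \<in> ?G" if "p \<in> ?G" for p
        using that perm[OF that] gen.inv_mem by (simp only: mem_Collect_eq c_inv)
    qed
    have "c (e57 n) = e99 n" "c (shift n) = shift n"
      using compl_e57_compl[OF n(1)] compl_shift_compl by (simp_all only: c_def)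
    then interpret e57_group n ?G
      by unfold_locales (auto intro: assms generate.incl)
    have even: "evenperm p" if "p \<in> ?G" for p
      using even99[of "c p"] c_even[OF permutes[OF that]] that by simp
    show "p \<in> ?gen (e99 n)" if "p permutes words n" "evenperm p" for p
      using even_mem_G[OF even c_perm] c_even that c_c by simp
  qed
qed

end
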